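(* Fix an integer $m\geq 0$. For integers $n\geq m$ and $0\leq k\leq n-m$ let $$NA_{\langle m\rangle}(n,k)=\frac{m+1}{n+2}\binom{n+2}{k+1}\binom{n-m}{k},$$ and set $NA_{\langle m\rangle}(n,k)=0$ for $k>n-m$. Consider the infinite lower-triangular matrices $$N_{A,\langle m\rangle}=\left[NA_{\langle m\rangle}(n,k)\right]_{n\geq m,\ k\geq 0}\quad\text{and}\quad \overleftarrow{N}_{A,\langle m\rangle}=\left[NA_{\langle m\rangle}(n,n-m-k)\right]_{n\geq m,\ k\geq 0},$$ where rows are indexed by $n\ge m$, columns by $k\ge 0$, and the entries with $k>n-m$ are $0$. Then both $N_{A,\langle m\rangle}$ and $\overleftarrow{N}_{A,\langle m\rangle}$ are totally positive.
   Context: A (finite or infinite) real matrix is totally positive (TP) if all of its minors are nonnegative. *)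

theory Defs
  imports Complex_Main "Jordan_Normal_Form.Determinant"
begin

text \<open>
  A finite or infinite real matrix is a function \<open>A\<close> together with the sets \<open>R\<close> and \<open>C\<close> of its
  row and column indices; values of \<open>A\<close> outside \<open>R \<times> C\<close> are irrelevant. A minor of order \<open>r\<close> is the
  determinant of the submatrix on rows \<open>p 0 < \<dots> < p (r - 1)\<close> and columns \<open>q 0 < \<dots> < q (r - 1)\<close>.
\<close>

definition minor :: "(nat \<Rightarrow> nat \<Rightarrow> real) \<Rightarrow> nat \<Rightarrow> (nat \<Rightarrow> nat) \<Rightarrow> (nat \<Rightarrow> nat) \<Rightarrow> real" where
  "minor A r p q = det (mat r r (\<lambda>(i, j). A (p i) (q j)))"

definition totally_positive :: "nat set \<Rightarrow> nat set \<Rightarrow> (nat \<Rightarrow> nat \<Rightarrow> real) \<Rightarrow> bool" where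
  "totally_positive R C A \<longleftrightarrow>
     (\<forall>r p q. strict_mono_on {..<r} p \<and> p ` {..<r} \<subseteq> R \<and>
              strict_mono_on {..<r} q \<and> q ` {..<r} \<subseteq> C \<longrightarrow> 0 \<le> minor A r p q)"

text \<open>Only arguments with \<open>n \<ge> m\<close> are meaningful.\<close>

definition NA :: "nat \<Rightarrow> nat \<Rightarrow> nat \<Rightarrow> real" where
  "NA m n k =
     (if k \<le> n - m
      then real (m + 1) / real (n + 2) * real ((n + 2) choose (k + 1)) * real ((n - m) choose k)
      else 0)"

text \<open>
  The explicit case distinction is needed: for \<open>k > n - m\<close> the truncated difference \<open>n - m - k\<close>
  is \<open>0\<close>, and \<open>NA m n 0\<close> is not zero.
\<close>

definition NA_rev :: "nat \<Rightarrow> nat \<Rightarrow> nat \<Rightarrow> real" where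
  "NA_rev m n k = (if k \<le> n - m then NA m n (n - m - k) else 0)"

end

theory Submission
  imports Defs
begin

text \<open>
  Writing the binomial coefficients with factorials and cancelling positive row and column factors,
  the first matrix becomes the Toeplitz matrix of the sequence \<open>1 / (j! (j + s)!)\<close> with
  \<open>s = m + 1\<close>, and the second one that of the same sequence with \<open>s = 1\<close>. This sequence is the
  limit, after rescaling, of the coefficients of the Laguerre polynomials at \<open>-x\<close>. These polynomials
  have only negative real roots, so they are products of factors \<open>x + \<rho>\<close> with \<open>\<rho> > 0\<close>. Multiplying a
  generating polynomial by \<open>x + \<rho>\<close> replaces each row of its Toeplitz matrix by \<open>\<rho>\<close> times itself plus
  the previous row, which preserves total positivity, as does the entrywise limit.
\<close>

text \<open>Without the case distinction, truncated subtraction would put \<open>c 0\<close> above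
  the diagonal.\<close>

definition toeplitz :: "(nat \<Rightarrow> real) \<Rightarrow> nat \<Rightarrow> nat \<Rightarrow> real" where
  "toeplitz c n k = (if k \<le> n then c (n - k) else 0)"

section \<open>Minors and operations that preserve total positivity\<close>

lemma totally_positiveI:
  assumes "\<And>r p q. strict_mono_on {..<r} p \<Longrightarrow> p ` {..<r} \<subseteq> R \<Longrightarrow>
                    strict_mono_on {..<r} q \<Longrightarrow> q ` {..<r} \<subseteq> C \<Longrightarrow> 0 \<le> minor A r p q"
  shows "totally_positive R C A"
  using assms unfolding totally_positive_def by blast

lemma totally_positiveD:
  assumes "totally_positive R C A" "strict_mono_on {..<r} p" "p ` {..<r} \<subseteq> R"
    "strict_mono_on {..<r} q" "q ` {..<r} \<subseteq> C"
  shows "0 \<le> minor A r p q"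
  using assms unfolding totally_positive_def by blast

lemma minor_permutation_sum:
  "minor A r p q = (\<Sum>\<sigma> | \<sigma> permutes {0..<r}. signof \<sigma> * (\<Prod>i=0..<r. A (p i) (q (\<sigma> i))))"
proof -
  have "minor A r p q = (\<Sum>\<sigma> | \<sigma> permutes {0..<r}. signof \<sigma> *
          (\<Prod>i=0..<r. mat r r (\<lambda>(i, j). A (p i) (q j)) $$ (i, \<sigma> i)))"
    unfolding minor_def by (rule det_def') simp
  also have "\<dots> = (\<Sum>\<sigma> | \<sigma> permutes {0..<r}. signof \<sigma> * (\<Prod>i=0..<r. A (p i) (q (\<sigma> i))))"
  proof (intro sum.cong refl arg_cong2[where f = "(*)"] prod.cong)
    fix \<sigma> i assume "\<sigma> \<in> {\<sigma>. \<sigma> permutes {0..<r}}" "i \<in> {0..<r}"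
    then have "i < r" "\<sigma> i < r" by (auto dest: permutes_in_image)
    then show "mat r r (\<lambda>(i, j). A (p i) (q j)) $$ (i, \<sigma> i) = A (p i) (q (\<sigma> i))" by simp
  qed
  finally show ?thesis .
qed

lemma totally_positive_tendsto:
  assumes tp: "\<And>N. totally_positive R C (A N)"
    and lim: "\<And>n k. (\<lambda>N. A N n k) \<longlonglongrightarrow> B n k"
  shows "totally_positive R C B"
proof (rule totally_positiveI)
  fix r and p q :: "nat \<Rightarrow> nat"
  assume pq: "strict_mono_on {..<r} p" "p ` {..<r} \<subseteq> R" "strict_mono_on {..<r} q" "q ` {..<r} \<subseteq> C"
  have "(\<lambda>N. minor (A N) r p q) \<longlonglongrightarrow> minor B r p q"
    unfolding minor_permutation_sum by (intro tendsto_intros lim)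
  moreover have "0 \<le> minor (A N) r p q" for N
    by (rule totally_positiveD[OF tp pq])
  ultimately show "0 \<le> minor B r p q"
    by (intro LIMSEQ_le_const) auto
qed

text \<open>Each term of the permutation sum meets every selected row and column once, so all scale
  factors come out of the minor as one nonnegative product. The map \<open>f\<close> serves row
  indices that do not start at 0.\<close>

lemma totally_positive_scale:
  assumes tp: "totally_positive UNIV UNIV A"
    and f: "strict_mono_on R f"
    and d: "\<And>n. 0 \<le> d n" and e: "\<And>k. 0 \<le> e k"
    and B: "\<And>n k. n \<in> R \<Longrightarrow> B n k = d n * e k * A (f n) k"
  shows "totally_positive R UNIV B"
proof (rule totally_positiveI)
  fix r and p q :: "nat \<Rightarrow> nat"
  assume p: "strict_mono_on {..<r} p" "p ` {..<r} \<subseteq> R" and q: "strict_mono_on {..<r} q"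
  have "minor B r p q = (\<Sum>\<sigma> | \<sigma> permutes {0..<r}.
      ((\<Prod>i=0..<r. d (p i)) * (\<Prod>i=0..<r. e (q i))) *
      (signof \<sigma> * (\<Prod>i=0..<r. A (f (p i)) (q (\<sigma> i)))))"
    unfolding minor_permutation_sum
  proof (rule sum.cong[OF refl])
    fix \<sigma> assume "\<sigma> \<in> {\<sigma>. \<sigma> permutes {0..<r}}"
    then have "(\<Prod>i=0..<r. e (q i)) = (\<Prod>i=0..<r. e (q (\<sigma> i)))"
      by (simp add: prod.permute[of \<sigma> _ "\<lambda>i. e (q i)"] o_def)
    moreover have "(\<Prod>i=0..<r. B (p i) (q (\<sigma> i)))
        = (\<Prod>i=0..<r. d (p i) * e (q (\<sigma> i)) * A (f (p i)) (q (\<sigma> i)))"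
      using p by (intro prod.cong refl B) auto
    ultimately show "signof \<sigma> * (\<Prod>i=0..<r. B (p i) (q (\<sigma> i))) =
      ((\<Prod>i=0..<r. d (p i)) * (\<Prod>i=0..<r. e (q i))) *
      (signof \<sigma> * (\<Prod>i=0..<r. A (f (p i)) (q (\<sigma> i))))"
      by (simp add: prod.distrib)
  qed
  also have "\<dots> = ((\<Prod>i=0..<r. d (p i)) * (\<Prod>i=0..<r. e (q i))) * minor A r (f \<circ> p) q"
    unfolding minor_permutation_sum by (simp add: sum_distrib_left)
  finally have eq: "minor B r p q = \<dots>" .
  have "strict_mono_on {..<r} (f \<circ> p)"
    using p f by (auto simp: strict_mono_on_def image_subset_iff)
  then have "0 \<le> minor A r (f \<circ> p) q"
    using q by (intro totally_positiveD[OF tp]) auto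
  then show "0 \<le> minor B r p q"
    unfolding eq by (intro mult_nonneg_nonneg prod_nonneg) (auto simp: d e)
qed

text \<open>The cofactors along row \<open>i\<close> do not involve the entries of that row, so the
  Laplace expansion is linear in them.\<close>

lemma det_row_linear:
  fixes u v :: "nat \<Rightarrow> 'a :: comm_ring_1"
  assumes "i < r"
  shows "det (mat r r (\<lambda>(a, b). if a = i then \<alpha> * u b + \<beta> * v b else F a b)) =
    \<alpha> * det (mat r r (\<lambda>(a, b). if a = i then u b else F a b)) +
    \<beta> * det (mat r r (\<lambda>(a, b). if a = i then v b else F a b))"
proof -
  let ?M = "\<lambda>w. mat r r (\<lambda>(a, b). if a = i then w b else F a b)"
  have cof: "cofactor (?M w) i j = cofactor (?M u) i j" if "j < r" for w j
  proof -
    have "mat_delete (?M w) i j = mat_delete (?M u) i j"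
      using that assms by (intro eq_matI) (auto simp: mat_delete_def)
    then show ?thesis by (simp add: cofactor_def)
  qed
  have expand: "det (?M w) = (\<Sum>j<r. w j * cofactor (?M u) i j)" for w
  proof -
    have "det (?M w) = (\<Sum>j<r. ?M w $$ (i, j) * cofactor (?M w) i j)"
      by (rule laplace_expansion_row) (use assms in auto)
    also have "\<dots> = (\<Sum>j<r. w j * cofactor (?M u) i j)"
      by (intro sum.cong refl arg_cong2[where f = "(*)"] cof) (use assms in auto)
    finally show ?thesis .
  qed
  show ?thesis
    unfolding expand by (simp add: sum.distrib sum_distrib_left algebra_simps)
qed

lemma totally_positive_add_previous_row:
  assumes tp: "totally_positive UNIV UNIV A"
    and nonneg: "0 \<le> a" "0 \<le> b"
    and B: "\<And>n k. B n k = a * A n k + b * (if n = 0 then 0 else A (n - 1) k)"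
  shows "totally_positive UNIV UNIV B"
proof (rule totally_positiveI)
  fix r and p q :: "nat \<Rightarrow> nat"
  assume p: "strict_mono_on {..<r} p" and q: "strict_mono_on {..<r} q"
  \<comment> \<open>\<open>M p r\<close> gives a minor of \<open>A\<close> and \<open>M p 0\<close>
    one of \<open>B\<close>. The induction below is on the number of rows taken from
    \<open>B\<close> and lets \<open>p\<close> vary, since lowering an index changes the row
    selection.\<close>
  define M where "M p t = mat r r (\<lambda>(i, j). if i < t then A (p i) (q j) else B (p i) (q j))"
    for p :: "nat \<Rightarrow> nat" and t
  \<comment> \<open>The rows are expanded from the first one on: when row \<open>t\<close> is expanded, row \<open>t - 1\<close> is already a
    row of \<open>A\<close>, so a collision of the lowered index \<open>p t - 1\<close> with \<open>p (t - 1)\<close> gives two equal rows.\<close>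
  have "0 \<le> det (M p (r - d))" if "strict_mono_on {..<r} p" "d \<le> r" for d p
    using that
  proof (induction d arbitrary: p)
    case 0
    have "M p r = mat r r (\<lambda>(i, j). A (p i) (q j))"
      unfolding M_def by (intro eq_matI) auto
    then show ?case
      using totally_positiveD[OF tp 0(1) _ q] by (simp add: minor_def)
  next
    case (Suc d)
    define t where "t = r - Suc d"
    have t: "t < r" "r - d = Suc t" using Suc.prems by (auto simp: t_def)
    define F where "F i j = (if i < t then A (p i) (q j) else B (p i) (q j))" for i j
    define v where "v j = (if p t = 0 then 0 else A (p t - 1) (q j))" for j
    let ?N = "\<lambda>w. mat r r (\<lambda>(i, j). if i = t then w j else F i j)"
    have "M p t = ?N (\<lambda>j. a * A (p t) (q j) + b * v j)"
      unfolding M_def F_def v_def by (intro eq_matI) (auto simp: B)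
    then have "det (M p t) = a * det (?N (\<lambda>j. A (p t) (q j))) + b * det (?N v)"
      by (simp add: det_row_linear[OF t(1)])
    moreover have "?N (\<lambda>j. A (p t) (q j)) = M p (Suc t)"
      unfolding M_def F_def by (intro eq_matI) auto
    then have "0 \<le> det (?N (\<lambda>j. A (p t) (q j)))"
      using Suc by (simp add: t)
    moreover have "0 \<le> det (?N v)"
    proof (cases "p t = 0")
      case True
      \<comment> \<open>Row 0 has no predecessor, so \<open>v\<close> is zero; written as a zero
        combination, it falls under \<open>det_row_linear\<close>.\<close>
      then have "?N v = ?N (\<lambda>j. 0 * v j + 0 * v j)"
        by (intro eq_matI) (auto simp: v_def)
      then have "det (?N v) = det \<dots>" by (rule arg_cong)
      then show ?thesis unfolding det_row_linear[OF t(1)] by simp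
    next
      case False
      define p' where "p' = p(t := p t - 1)"
      have Np: "?N v = M p' (Suc t)"
        unfolding M_def F_def v_def p'_def using False by (intro eq_matI) auto
      have less: "p i < p j" if "i < j" "j < r" for i j
        using Suc.prems(1) that by (auto simp: strict_mono_on_def)
      show ?thesis
      proof (cases "strict_mono_on {..<r} p'")
        case True
        then show ?thesis using Suc.IH[OF True] Suc.prems by (simp add: t Np)
      next
        case neq: False
        have "\<exists>i<t. p i = p t - 1"
        proof (rule ccontr)
          assume none: "\<not> ?thesis"
          have "p' i < p' j" if "i < j" "j < r" for i j
            using less[OF that] less[of i t] that none
            by (cases "j = t"; cases "i = t") (force simp: p'_def)+
          then show False using neq by (auto simp: strict_mono_on_def)
        qed
        then obtain i where "i < t" "p i = p t - 1" by blast
        then have "row (?N v) i = row (?N v) t"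
          using t False by (intro eq_vecI) (auto simp: F_def v_def)
        then have "det (?N v) = 0"
          using \<open>i < t\<close> t by (intro det_identical_rows[of _ r i t]) auto
        then show ?thesis by simp
      qed
    qed
    ultimately show ?case using nonneg by (simp add: t_def)
  qed
  from this[OF p le_refl] have "0 \<le> det (M p 0)" by simp
  then show "0 \<le> minor B r p q" by (simp add: M_def minor_def)
qed

section \<open>Toeplitz matrices of polynomials with nonpositive roots\<close>

lemma strict_mono_on_lessThan_eqI:
  fixes p q :: "nat \<Rightarrow> nat"
  assumes p: "strict_mono_on {..<r} p" and q: "strict_mono_on {..<r} q"
    and im: "p ` {..<r} = q ` {..<r}" and i: "i < r"
  shows "p i = q i"
proof -
  have sorted: "sorted (map f [0..<r]) \<and> distinct (map f [0..<r])"
    if "strict_mono_on {..<r} f" for f :: "nat \<Rightarrow> nat"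
    using that strict_mono_on_imp_inj_on[OF that]
    by (auto simp: sorted_iff_nth_mono_less distinct_map strict_mono_on_def less_imp_le lessThan_atLeast0)
  have "map p [0..<r] = map q [0..<r]"
    using sorted[OF p] sorted[OF q] im
    by (intro sorted_distinct_set_unique) (auto simp: lessThan_atLeast0)
  then show ?thesis using i by (auto)
qed

text \<open>If some selected row index is not a selected column index, that row vanishes. Otherwise
  the index sets agree and the submatrix is an identity matrix.\<close>

lemma totally_positive_identity:
  "totally_positive UNIV UNIV (\<lambda>n k. if n = k then 1 else 0)"
proof (rule totally_positiveI)
  fix r and p q :: "nat \<Rightarrow> nat"
  assume p: "strict_mono_on {..<r} p" and q: "strict_mono_on {..<r} q"
  let ?I = "\<lambda>n k. if n = k then 1 else 0 :: real"
  let ?M = "mat r r (\<lambda>(i, j). ?I (p i) (q j))"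
  show "0 \<le> minor ?I r p q"
  proof (cases "p ` {..<r} \<subseteq> q ` {..<r}")
    case True
    have "card (p ` {..<r}) = card (q ` {..<r})"
      using p q by (simp add: card_image strict_mono_on_imp_inj_on)
    with True have "p ` {..<r} = q ` {..<r}"
      by (intro card_subset_eq) auto
    then have "p i = q i" if "i < r" for i
      using strict_mono_on_lessThan_eqI[OF p q] that by blast
    moreover have "q i = q j \<longleftrightarrow> i = j" if "i < r" "j < r" for i j
      using strict_mono_on_imp_inj_on[OF q] that by (auto simp: inj_on_def)
    ultimately have "?M = 1\<^sub>m r" by (intro eq_matI) auto
    then show ?thesis by (simp add: minor_def)
  next
    case False
    then obtain i where i: "i < r" "p i \<notin> q ` {..<r}" by blast
    have "det ?M = (\<Sum>j<r. ?M $$ (i, j) * cofactor ?M i j)"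
      by (rule laplace_expansion_row) (use i in auto)
    also have "\<dots> = 0" using i by (intro sum.neutral) auto
    finally show ?thesis by (simp add: minor_def)
  qed
qed

lemma totally_positive_toeplitz_prod:
  fixes r :: "nat \<Rightarrow> real"
  assumes "\<And>i. i < N \<Longrightarrow> r i \<le> 0"
  shows "totally_positive UNIV UNIV (toeplitz (poly.coeff (\<Prod>i<N. [:- r i, 1:])))"
  using assms
proof (induction N)
  case 0
  have "toeplitz (poly.coeff (1 :: real poly)) = (\<lambda>n k. if n = k then 1 else 0)"
    by (auto simp: toeplitz_def fun_eq_iff)
  then show ?case by (simp only: lessThan_0 prod.empty totally_positive_identity)
next
  case (Suc N)
  let ?g = "\<Prod>i<N. [:- r i, 1:]"
  have "toeplitz (poly.coeff (\<Prod>i<Suc N. [:- r i, 1:])) n k =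
      - r N * toeplitz (poly.coeff ?g) n k +
      1 * (if n = 0 then 0 else toeplitz (poly.coeff ?g) (n - 1) k)" for n k
  proof -
    have "(\<Prod>i<Suc N. [:- r i, 1:]) = smult (- r N) ?g + pCons 0 ?g"
      by (simp add: mult.commute)
    then show ?thesis
      by (cases n; cases "k \<le> n - 1") (auto simp: toeplitz_def Suc_diff_le le_Suc_eq)
  qed
  then show ?case
    by (rule totally_positive_add_previous_row[OF Suc.IH, rotated 3]) (use Suc.prems in auto)
qed

section \<open>Real roots of the Laguerre polynomials\<close>

text \<open>Each sign change yields a root, so \<open>p\<close> has \<open>n\<close> distinct ones.
  Both \<open>p\<close> and the product are monic of degree \<open>n\<close> and agree at these
  points, hence coincide.\<close>

lemma poly_split_of_sign_changes:
  fixes p :: "real poly" and t :: "nat \<Rightarrow> real"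
  assumes monic: "degree p \<le> n" "poly.coeff p n = 1"
    and t: "\<And>i. i < n \<Longrightarrow> t (Suc i) < t i"
    and sgn: "\<And>i. i \<le> n \<Longrightarrow> 0 < (-1) ^ i * poly p (t i)"
  obtains r where "\<And>i. i < n \<Longrightarrow> t (Suc i) < r i \<and> r i < t i"
    and "\<And>i j. i < j \<Longrightarrow> j < n \<Longrightarrow> r j < r i"
    and "p = (\<Prod>i<n. [:- r i, 1:])"
proof -
  have "\<exists>x. t (Suc i) < x \<and> x < t i \<and> poly p x = 0" if "i < n" for i
  proof (cases "even i")
    case True
    then show ?thesis
      using t[OF that] sgn[of i] sgn[of "Suc i"] that by (intro poly_IVT_pos) auto
  next
    case False
    then show ?thesis
      using t[OF that] sgn[of i] sgn[of "Suc i"] that by (intro poly_IVT_neg) auto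
  qed
  then obtain r where r: "\<And>i. i < n \<Longrightarrow> t (Suc i) < r i \<and> r i < t i \<and> poly p (r i) = 0"
    by metis
  have anti: "t j \<le> t i" if "i \<le> j" "j \<le> n" for i j
    using that
  proof (induction j rule: dec_induct)
    case (step j)
    then show ?case using t[of j] by simp
  qed simp
  have decr: "r j < r i" if "i < j" "j < n" for i j
    using r[of i] r[of j] anti[of "Suc i" j] that by simp
  have "inj_on r {..<n}"
    by (rule linorder_inj_onI) (use decr in force)+
  then have card: "card (r ` {..<n}) = n"
    by (simp add: card_image)
  let ?q = "\<Prod>i<n. [:- r i, 1:]"
  have deg: "degree ?q = n"
    by (subst degree_prod_eq_sum_degree) auto
  have "lead_coeff ?q = 1"
    by (simp add: lead_coeff_prod)
  then have "p = ?q"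
    using deg card monic r
    by (intro poly_eqI_degree_lead_coeff[of p n ?q "r ` {..<n}"]) (auto simp: poly_prod)
  with r decr show ?thesis using that by blast
qed

text \<open>The polynomial \<open>(-1)^n * p(-x)\<close> has the leading coefficient of
  \<open>p\<close> and is therefore positive for large \<open>x\<close>.\<close>

lemma poly_sign_at_minus_infinity:
  fixes p :: "real poly"
  assumes "degree p = n" "lead_coeff p > 0"
  obtains x where "x < c" "0 < (-1) ^ n * poly p x"
proof -
  define q where "q = smult ((-1) ^ n) (pcompose p [:0, -1:])"
  have "lead_coeff q = lead_coeff p"
    using assms by (simp add: q_def lead_coeff_comp flip: power_mult_distrib)
  then obtain b where b: "\<And>x. x \<ge> b \<Longrightarrow> lead_coeff p \<le> poly q x"
    using poly_pinfty_gt_lc[of q] assms(2) by auto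
  let ?x = "max b (1 - c)"
  have "0 < poly q ?x" using b[of ?x] assms(2) by simp
  then have "0 < (-1) ^ n * poly p (- ?x)" by (simp add: q_def poly_pcompose)
  moreover have "- ?x < c" by simp
  ultimately show ?thesis using that by blast
qed

text \<open>The Laguerre polynomials up to normalization: \<open>laguerre N s\<close> is \<open>N!\<close> times the
  generalized Laguerre polynomial of degree \<open>N\<close> and parameter \<open>s\<close>, evaluated at \<open>-x\<close>.\<close>

fun laguerre :: "nat \<Rightarrow> nat \<Rightarrow> real poly" where
  "laguerre 0 s = 1"
| "laguerre (Suc N) s =
     [:real s + 1, 1:] * laguerre N (Suc s) + pCons 0 (pderiv (laguerre N (Suc s)))"

text \<open>The factor \<open>j + s + 1\<close> from the recurrence cancels against
  \<open>fact (j + s + 1)\<close>, and Pascal's rule adds the two remaining terms.\<close>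

lemma coeff_laguerre:
  "poly.coeff (laguerre N s) j = real (N choose j) * fact (N + s) / fact (j + s)"
proof (induction N arbitrary: s j)
  case 0
  then show ?case by (cases j) auto
next
  case (Suc N)
  have f: "(fact (Suc (j + s)) :: real) = (real j + real s + 1) * fact (j + s)" for j
    by simp
  have nz: "real j + real s + 1 \<noteq> 0" for j by linarith
  show ?case
  proof (cases j)
    case 0
    have "poly.coeff (laguerre (Suc N) s) 0 = (real s + 1) * poly.coeff (laguerre N (Suc s)) 0"
      by simp
    also have "\<dots> = (real s + 1) * (fact (Suc N + s) / fact (Suc s))"
      by (simp add: Suc del: fact_Suc)
    also have "\<dots> = fact (Suc N + s) / fact s"
      using f[of 0] nz[of 0] by (simp del: fact_Suc)
    finally show ?thesis by (simp add: 0)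
  next
    case j: (Suc i)
    have "poly.coeff (laguerre (Suc N) s) j =
        (real s + 1 + real j) * poly.coeff (laguerre N (Suc s)) j + poly.coeff (laguerre N (Suc s)) i"
      by (simp add: j coeff_pderiv algebra_simps)
    also have "\<dots> = (real j + real s + 1) * (real (N choose j) * fact (Suc N + s) / fact (Suc (j + s)))
        + real (N choose i) * fact (Suc N + s) / fact (j + s)"
      by (simp add: Suc j algebra_simps del: fact_Suc)
    also have "\<dots> = real (N choose j) * fact (Suc N + s) / fact (j + s)
        + real (N choose i) * fact (Suc N + s) / fact (j + s)"
      unfolding f using nz[of j] by simp
    also have "\<dots> = real (Suc N choose j) * fact (Suc N + s) / fact (j + s)"
      by (simp add: j add_divide_distrib algebra_simps del: fact_Suc)
    finally show ?thesis .
  qed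
qed

lemma degree_laguerre: "degree (laguerre N s) = N"
  by (intro antisym degree_le le_degree) (auto simp: coeff_laguerre)

text \<open>Induction on \<open>N\<close> for all \<open>s\<close> at once: the signs of the next
  polynomial alternate at 0, at the roots of the previous one, and far to the left. The strict order
  of the roots is carried along because the alternation relies on simple roots.\<close>

lemma laguerre_split:
  obtains r where "\<And>i. i < N \<Longrightarrow> r i < 0" "\<And>i j. i < j \<Longrightarrow> j < N \<Longrightarrow> r j < r i"
    "laguerre N s = (\<Prod>i<N. [:- r i, 1:])"
proof -
  have "\<exists>r. (\<forall>i<N. r i < 0) \<and> (\<forall>i j. i < j \<longrightarrow> j < N \<longrightarrow> r j < r i) \<and>
    laguerre N s = (\<Prod>i<N. [:- r i, 1:])"
  proof (induction N arbitrary: s)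
    case 0
    then show ?case by simp
  next
    case (Suc N)
    define g where "g = laguerre N (Suc s)"
    define p where "p = laguerre (Suc N) s"
    obtain r where neg: "\<And>i. i < N \<Longrightarrow> r i < 0"
      and decr: "\<And>i j. i < j \<Longrightarrow> j < N \<Longrightarrow> r j < r i"
      and g: "g = (\<Prod>i<N. [:- r i, 1:])"
      using Suc[of "Suc s"] unfolding g_def by blast
    have p: "poly p x = (real s + 1 + x) * poly g x + x * poly (pderiv g) x" for x
      by (simp add: p_def g_def algebra_simps)
    \<comment> \<open>At a root of \<open>g\<close> only the term \<open>x g'\<close> survives, and \<open>g'\<close> alternates in sign along the roots.\<close>
    have at_root: "0 < (-1) ^ Suc i * poly p (r i)" if "i < N" for i
    proof -
      let ?h = "\<lambda>A. \<Prod>j\<in>A. [:- r j, 1:]"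
      have "g = [:- r i, 1:] * ?h ({..<N} - {i})"
        unfolding g using that by (intro prod.remove) auto
      then have "poly g (r i) = 0"
        "poly (pderiv g) (r i) = poly (?h ({..<N} - {i})) (r i)"
        by (simp_all add: pderiv_mult pderiv_pCons del: mult_pCons_left)
      moreover have "?h ({..<N} - {i}) = ?h {..<i} * ?h {i<..<N}"
      proof -
        have "{..<N} - {i} = {..<i} \<union> {i<..<N}"
          using that by auto
        then have "?h ({..<N} - {i}) = ?h ({..<i} \<union> {i<..<N})"
          by (rule arg_cong)
        also have "\<dots> = ?h {..<i} * ?h {i<..<N}"
          by (rule prod.union_disjoint) auto
        finally show ?thesis .
      qed
      \<comment> \<open>The \<open>i\<close> roots above \<open>r i\<close> contribute negative
        factors, whose signs \<open>(-1) ^ i\<close> cancels; the roots below contribute positive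
        ones, and \<open>- r i\<close> is positive.\<close>
      ultimately have "(-1) ^ Suc i * poly p (r i) =
          - r i * ((-1) ^ i * poly (?h {..<i}) (r i)) * poly (?h {i<..<N}) (r i)"
        by (simp add: p)
      moreover have "(\<Prod>j<i. r j - r i) = (\<Prod>j<i. (-1) * (r i - r j))"
        by simp
      then have "(-1) ^ i * poly (?h {..<i}) (r i) = (\<Prod>j<i. r j - r i)"
        by (simp only: poly_prod prod.distrib prod_constant card_lessThan) simp
      moreover have "0 < (\<Prod>j<i. r j - r i)"
        using decr that by (intro prod_pos) auto
      moreover have "0 < poly (?h {i<..<N}) (r i)"
        unfolding poly_prod using decr by (intro prod_pos) auto
      ultimately show ?thesis
        using neg[OF that] by (simp only: mult_pos_pos neg_0_less_iff_less)
    qed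
    obtain c where c: "c < (if N = 0 then 0 else r (N - 1))" "0 < (-1) ^ Suc N * poly p c"
      using poly_sign_at_minus_infinity[of p "Suc N"]
      by (auto simp: p_def degree_laguerre coeff_laguerre simp del: laguerre.simps)
    \<comment> \<open>The sign of \<open>p\<close> alternates along these \<open>N + 2\<close>
      points. Starting at 0, where \<open>p\<close> is positive, makes all new roots
      negative.\<close>
    define t where "t i = (if i = 0 then 0 else if i \<le> N then r (i - 1) else c)" for i
    have t: "t (Suc i) < t i" if "i < Suc N" for i
      using that c(1) neg decr[of "i - 1" i] by (cases "i = N") (auto simp: t_def)
    have p0: "0 < poly p 0"
      by (simp add: p_def poly_0_coeff_0 coeff_laguerre del: laguerre.simps)
    have sgn: "0 < (-1) ^ i * poly p (t i)" if "i \<le> Suc N" for i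
    proof (cases i)
      case 0
      then show ?thesis using p0 by (simp add: t_def)
    next
      case (Suc k)
      then show ?thesis using at_root[of k] c(2) that by (cases "k = N") (auto simp: t_def)
    qed
    have monic: "degree p \<le> Suc N" "poly.coeff p (Suc N) = 1"
      by (simp_all add: p_def degree_laguerre coeff_laguerre del: laguerre.simps)
    obtain u where u: "\<And>i. i < Suc N \<Longrightarrow> t (Suc i) < u i \<and> u i < t i"
      "\<And>i j. i < j \<Longrightarrow> j < Suc N \<Longrightarrow> u j < u i" "p = (\<Prod>i<Suc N. [:- u i, 1:])"
      using poly_split_of_sign_changes[OF monic t sgn] by blast
    have "u i < 0" if "i < Suc N" for i
    proof -
      have "u i \<le> u 0" using u(2)[of 0 i] that by (cases "i = 0") auto
      also have "u 0 < 0" using u(1)[of 0] by (simp add: t_def)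
      finally show ?thesis .
    qed
    then show ?case using u(2,3) unfolding p_def by blast
  qed
  then show ?thesis using that by blast
qed

section \<open>Limit of the rescaled Laguerre coefficients\<close>

text \<open>For \<open>N > j\<close>, passing from \<open>j\<close> to \<open>j + 1\<close>
  multiplies the quotient by \<open>(1 - j / N) / (j + 1)\<close>.\<close>

lemma binomial_over_power_tendsto:
  "(\<lambda>N. real (N choose j) / real N ^ j) \<longlonglongrightarrow> 1 / fact j"
proof (induction j)
  case 0
  then show ?case by simp
next
  case (Suc j)
  have "(\<lambda>N. real (N choose j) / real N ^ j * ((1 - real j / real N) / real (Suc j)))
      \<longlonglongrightarrow> 1 / fact j * ((1 - 0) / real (Suc j))"
    by (intro tendsto_intros Suc lim_const_over_n) auto
  moreover have "\<forall>\<^sub>F N in sequentially.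
      real (N choose j) / real N ^ j * ((1 - real j / real N) / real (Suc j)) =
      real (N choose Suc j) / real N ^ Suc j"
    using eventually_gt_at_top[of j]
  proof eventually_elim
    case (elim N)
    have "Suc j * (N choose Suc j) = (N - j) * (N choose j)"
      by (metis binomial_absorb_comp binomial_absorption)
    then have "real (Suc j) * real (N choose Suc j) = (real N - real j) * real (N choose j)"
      using elim by (metis less_imp_le of_nat_diff of_nat_mult)
    then have "real (N choose Suc j) = (real N - real j) * real (N choose j) / real (Suc j)"
      by (simp add: nonzero_eq_divide_eq mult.commute del: of_nat_Suc binomial_Suc_Suc)
    moreover have "1 - real j / real N = (real N - real j) / real N"
      using elim by (simp add: diff_divide_distrib)
    ultimately show ?case by (simp add: mult_ac del: of_nat_Suc binomial_Suc_Suc)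
  qed
  ultimately show ?case
    by (auto elim: Lim_transform_eventually simp: mult.commute)
qed

text \<open>The generating function of this sequence is \<open>x^(-s/2) * I_s(2 * sqrt x)\<close>,
  with \<open>I_s\<close> the modified Bessel function of the first kind.\<close>

lemma totally_positive_toeplitz_bessel:
  "totally_positive UNIV UNIV (toeplitz (\<lambda>j. 1 / (fact j * fact (j + s))))"
proof (rule totally_positive_tendsto)
  let ?A = "\<lambda>N. toeplitz (\<lambda>j. poly.coeff (laguerre N s) j / (fact (N + s) * real N ^ j))"
  \<comment> \<open>The shift to \<open>Suc N\<close> keeps the base of the powers nonzero, so that
    the power with exponent \<open>n - k\<close> splits into a row factor and a column
    factor.\<close>
  show "totally_positive UNIV UNIV (?A (Suc N))" for N
  proof -
    let ?N = "Suc N"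
    obtain r where r: "\<And>i. i < ?N \<Longrightarrow> r i < 0" "laguerre ?N s = (\<Prod>i<?N. [:- r i, 1:])"
      using laguerre_split[of ?N s] by metis
    have "totally_positive UNIV UNIV (toeplitz (poly.coeff (laguerre ?N s)))"
      unfolding r(2) using r(1) by (intro totally_positive_toeplitz_prod) (simp add: less_imp_le)
    then show ?thesis
      by (rule totally_positive_scale[where f = id and d = "\<lambda>n. 1 / (fact (?N + s) * real ?N ^ n)"
            and e = "\<lambda>k. real ?N ^ k"])
         (auto simp: toeplitz_def power_diff strict_mono_on_def simp del: laguerre.simps of_nat_Suc)
  qed
  have "(\<lambda>N. poly.coeff (laguerre N s) j / (fact (N + s) * real N ^ j))
      \<longlonglongrightarrow> 1 / fact j * (1 / fact (j + s))" for j
  proof -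
    have "(\<lambda>N. poly.coeff (laguerre N s) j / (fact (N + s) * real N ^ j))
        = (\<lambda>N. real (N choose j) / real N ^ j * (1 / fact (j + s)))"
      by (simp add: coeff_laguerre fun_eq_iff)
    then show ?thesis
      by (simp only: tendsto_mult[OF binomial_over_power_tendsto tendsto_const])
  qed
  then have "(\<lambda>N. ?A N n k) \<longlonglongrightarrow> toeplitz (\<lambda>j. 1 / (fact j * fact (j + s))) n k" for n k
    by (cases "k \<le> n") (simp_all add: toeplitz_def del: add_diff_assoc2)
  then show "(\<lambda>N. ?A (Suc N) n k) \<longlonglongrightarrow> toeplitz (\<lambda>j. 1 / (fact j * fact (j + s))) n k" for n k
    by (rule LIMSEQ_Suc)
qed

section \<open>The two Narayana-type matrices\<close>

text \<open>The factor \<open>n + 2\<close> cancels. Each remaining factor depends on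
  \<open>n\<close>, on \<open>k\<close> or on \<open>n - m - k\<close> alone; those of the last kind
  form the Toeplitz entry.\<close>

lemma NA_eq_fact:
  assumes "n \<ge> m" "k \<le> n - m"
  shows "NA m n k = real (m + 1) * fact (n + 1) * fact (n - m) /
    (fact k * fact (k + 1) * fact (n - m - k) * fact (n - m - k + (m + 1)))"
proof -
  have "n + 2 - (k + 1) = n - m - k + (m + 1)" using assms by simp
  then have "real ((n + 2) choose (k + 1)) = 
      real (n + 2) * fact (n + 1) / (fact (k + 1) * fact (n - m - k + (m + 1)))"
    using assms by (subst binomial_fact) (auto simp: fact_Suc[of "Suc n"] simp del: fact_Suc)
  moreover have "real ((n - m) choose k) = fact (n - m) / (fact k * fact (n - m - k))"
    using assms by (subst binomial_fact) auto
  ultimately show ?thesis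
    using assms by (simp add: NA_def del: fact_Suc of_nat_Suc of_nat_add)
qed

lemma strict_mono_on_diff_const: "strict_mono_on {m..} (\<lambda>n :: nat. n - m)"
  by (auto simp: strict_mono_on_def)

theorem theorem2p3:
  fixes m :: nat
  shows "totally_positive {m..} UNIV (NA m) \<and> totally_positive {m..} UNIV (NA_rev m)"
proof
  let ?d = "\<lambda>n. real (m + 1) * fact (n + 1) * fact (n - m)"
  show "totally_positive {m..} UNIV (NA m)"
  proof (rule totally_positive_scale[OF totally_positive_toeplitz_bessel[of "m + 1"]
        strict_mono_on_diff_const])
    show "NA m n k = ?d n * (1 / (fact k * fact (k + 1))) *
        toeplitz (\<lambda>j. 1 / (fact j * fact (j + (m + 1)))) (n - m) k" if "n \<in> {m..}" for n k
    proof (cases "k \<le> n - m")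
      case True
      then show ?thesis using that NA_eq_fact[of m n k] by (simp add: toeplitz_def mult_ac)
    qed (simp add: toeplitz_def NA_def)
  qed auto
  show "totally_positive {m..} UNIV (NA_rev m)"
  proof (rule totally_positive_scale[OF totally_positive_toeplitz_bessel[of 1]
        strict_mono_on_diff_const])
    \<comment> \<open>Reversal exchanges \<open>k\<close> and \<open>n - m - k\<close>, so the shift
      in the Toeplitz factor is now 1 and \<open>m + 1\<close> moves to the column factor.\<close>
    show "NA_rev m n k = ?d n * (1 / (fact k * fact (k + (m + 1)))) *
        toeplitz (\<lambda>j. 1 / (fact j * fact (j + 1))) (n - m) k" if "n \<in> {m..}" for n k
    proof (cases "k \<le> n - m")
      case True
      then show ?thesis
        using that NA_eq_fact[of m n "n - m - k"] by (simp add: toeplitz_def NA_rev_def mult_ac)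
    qed (simp add: toeplitz_def NA_rev_def)
  qed auto
qed

end
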